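(* Let $b$ be a prime, let $e\ge 1$, let $p\in\mathrm{GF}(b)[x]$ have degree $e$, and let $c_1,c_2\in\mathrm{GF}(b)$ be such that $p+c_1$ and $p+c_2$ are distinct irreducible polynomials of degree $e$. Let $M^{(c_1)}$ and $M^{(c_2)}$ be Sobol' matrices of $p+c_1$ and $p+c_2$, with arbitrary invertible upper triangular initialization matrices $M^{(c_1)}_{[e\times e]}$ and $M^{(c_2)}_{[e\times e]}$. Put $\alpha=c_1-c_2$, let $K=M^{(c_2)}\left(M^{(c_1)}\right)^{-1}$, and let $K_{[e\times e]}=M^{(c_2)}_{[e\times e]}\left(M^{(c_1)}_{[e\times e]}\right)^{-1}$. Then for every $m\ge 1$, $$K_{[em\times em]}=\mathcal{P}^{\alpha}\otimes K_{[e\times e]},$$ where $\mathcal{P}^{\alpha}$ is the $m\times m$ matrix over $\mathrm{GF}(b)$ with entries $\mathcal{P}^{\alpha}_{i,j}=\binom{j-1}{i-1}\alpha^{j-i}$ for $1\le i,j\le m$. Equivalently, the $e\times e$ blocks $K_{i,j}$ ($i,j\ge 1$) of the infinite matrix $K$ satisfy $$K_{i,j}=\alpha\,K_{i,j-1}+K_{i-1,j-1}\quad (i\ge 1,\ j\ge 2),\qquad K_{i,1}=\delta_{i,1}\,K_{[e\times e]},$$ with the convention $K_{0,j}=0$.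
   Context: All matrices have entries in $\mathrm{GF}(b)$, $b$ prime. For an infinite matrix $A$ (rows and columns indexed by positive integers), $A_{[k\times k]}$ denotes its top-left $k\times k$ submatrix. Sobol' matrix (block recurrence). Let $p(x)=\sum_{i=0}^{e}a_ix^i$ be a polynomial of degree $e$ over $\mathrm{GF}(b)$. Let $Q_p$ be the $e\times e$ lower triangular Toeplitz matrix with $(u,v)$ entry $-a_{u-v}$ for $u\ge v$ and $0$ for $u<v$ ($1\le u,v\le e$). Let $F_p$ be the inverse of the $e\times e$ upper unitriangular Toeplitz matrix $F_p^{-1}$ whose $(u,v)$ entry is $1$ if $u=v$, $-a_{e-(v-u)}$ if $v>u$, and $0$ if $v<u$ (so the first row of $F_p^{-1}$ is $1,-a_{e-1},-a_{e-2},\dots,-a_1$). Given an invertible upper triangular $e\times e$ initialization matrix $M_{[e\times e]}$, the Sobol' matrix $M$ of $p$ is the infinite matrix with $e\times e$ blocks $M_{i,j}$, $i,j\ge1$, defined by $M_{i,1}=\delta_{i,1}M_{[e\times e]}$ and $$M_{i,j}=\left(M_{i,j-1}Q_p+M_{i-1,j-1}\right)F_p\qquad (i\ge1,\ j\ge2),$$ with $M_{0,j}=0$. The matrix $M$ is upper triangular with nonzero diagonal entries, so its inverse (as an infinite upper triangular matrix) and products of such matrices are well defined and compatible with truncation. For a shifted polynomial $p+c$, $c\in\mathrm{GF}(b)$, its Sobol' matrix is denoted $M^{(c)}$. Conventions: $A\otimes B$ is the block matrix whose $(i,j)$ block is $A_{i,j}B$; $\binom{j-1}{i-1}$ is reduced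 modulo $b$; $\binom{j-1}{i-1}\alpha^{j-i}$ is understood to be $0$ when $j<i$, and $\alpha^0=1$. *)

theory Defs
  imports
    "Berlekamp_Zassenhaus.Finite_Field"
    "Jordan_Normal_Form.Gauss_Jordan_Elimination"
    "HOL-Computational_Algebra.Polynomial"
    "HOL-Library.Groups_Big_Fun"
begin

(* Index conventions: entries of finite and infinite matrices are indexed from 0, as in
   Jordan_Normal_Form; blocks are indexed from 1, index 0 being kept for the boundary
   conventions such as M_{0,j} = 0. *)

subsection \<open>Infinite matrices\<close>

type_synonym 'a inf_mat = "nat \<Rightarrow> nat \<Rightarrow> 'a"

definition inf_one :: "'a :: {zero,one} inf_mat" where
  "inf_one = (\<lambda>i j. if i = j then 1 else 0)"

definition inf_upper_triangular :: "'a :: zero inf_mat \<Rightarrow> bool" where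
  "inf_upper_triangular A \<longleftrightarrow> (\<forall>i j. j < i \<longrightarrow> A i j = 0)"

(* Meaningful when all the sums have finitely many nonzero terms,
   in particular when B is upper triangular. *)
definition inf_mult :: "'a :: semiring_0 inf_mat \<Rightarrow> 'a inf_mat \<Rightarrow> 'a inf_mat" where
  "inf_mult A B = (\<lambda>i j. Sum_any (\<lambda>k. A i k * B k j))"

definition inf_inverse :: "'a :: semiring_1 inf_mat \<Rightarrow> 'a inf_mat" where
  "inf_inverse A =
     (THE B. inf_upper_triangular B \<and> inf_mult A B = inf_one \<and> inf_mult B A = inf_one)"

definition truncate_mat :: "nat \<Rightarrow> 'a inf_mat \<Rightarrow> 'a mat" where
  "truncate_mat k A = mat k k (\<lambda>(r, s). A r s)"

definition inf_block :: "nat \<Rightarrow> 'a :: zero inf_mat \<Rightarrow> nat \<Rightarrow> nat \<Rightarrow> 'a mat" where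
  "inf_block e A i j =
     (if i = 0 then 0\<^sub>m e e
      else mat e e (\<lambda>(u, v). A ((i - 1) * e + u) ((j - 1) * e + v)))"

subsection \<open>Finite matrices\<close>

definition kronecker :: "'a :: times mat \<Rightarrow> 'a mat \<Rightarrow> 'a mat" where
  "kronecker A B = mat (dim_row A * dim_row B) (dim_col A * dim_col B)
     (\<lambda>(r, s). A $$ (r div dim_row B, s div dim_col B) * B $$ (r mod dim_row B, s mod dim_col B))"

definition pascal_mat :: "'a :: comm_semiring_1 \<Rightarrow> nat \<Rightarrow> 'a mat" where
  "pascal_mat \<alpha> m = mat m m (\<lambda>(i, j). if j < i then 0 else of_nat (j choose i) * \<alpha> ^ (j - i))"

(* Only to be used for invertible matrices. *)
definition mat_inv :: "'a :: field mat \<Rightarrow> 'a mat" where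
  "mat_inv A = the (mat_inverse A)"

subsection \<open>Sobol' matrices\<close>

definition Q_mat :: "'a :: field poly \<Rightarrow> 'a mat" where
  "Q_mat p = mat (degree p) (degree p) (\<lambda>(u, v). if v \<le> u then - coeff p (u - v) else 0)"

definition F_inv_mat :: "'a :: field poly \<Rightarrow> 'a mat" where
  "F_inv_mat p = mat (degree p) (degree p)
     (\<lambda>(u, v). if u = v then 1 else if u < v then - coeff p (degree p - (v - u)) else 0)"

definition F_mat :: "'a :: field poly \<Rightarrow> 'a mat" where
  "F_mat p = mat_inv (F_inv_mat p)"

(* The value at j = 0 is a dummy. *)
fun sobol_block :: "'a :: field poly \<Rightarrow> 'a mat \<Rightarrow> nat \<Rightarrow> nat \<Rightarrow> 'a mat" where
  "sobol_block p M0 i 0 = 0\<^sub>m (degree p) (degree p)"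
| "sobol_block p M0 i (Suc 0) = (if i = 1 then M0 else 0\<^sub>m (degree p) (degree p))"
| "sobol_block p M0 i (Suc (Suc j)) =
     (if i = 0 then 0\<^sub>m (degree p) (degree p)
      else (sobol_block p M0 i (Suc j) * Q_mat p + sobol_block p M0 (i - 1) (Suc j)) * F_mat p)"

definition sobol_mat :: "'a :: field poly \<Rightarrow> 'a mat \<Rightarrow> 'a inf_mat" where
  "sobol_mat p M0 = (\<lambda>r s.
     sobol_block p M0 (r div degree p + 1) (s div degree p + 1) $$ (r mod degree p, s mod degree p))"

end

theory Submission
  imports Defs "Jordan_Normal_Form.Determinant"
begin

text \<open>Adding a constant to \<open>p\<close> leaves \<open>F_mat p\<close> unchanged and alters \<open>Q_mat p\<close> only by a scalar matrix:
  \<open>Q\<^sub>2 = Q\<^sub>1 + \<alpha> I\<close>. Pascal's rule \<open>c(i,j+1) = \<alpha> c(i,j) + c(i-1,j)\<close> for the entries of the Pascal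
  matrix absorbs exactly this scalar, so the Kronecker product of the infinite Pascal matrix with
  \<open>K0\<close>, multiplied by the Sobol' matrix of \<open>p + c\<^sub>1\<close>, satisfies the block recurrence of the Sobol' matrix
  of \<open>p + c\<^sub>2\<close> with the same first block column. Cancelling the invertible Sobol' matrix
  of \<open>p + c\<^sub>1\<close> identifies \<open>K\<close>.\<close>

subsection \<open>Infinite upper triangular matrices\<close>

text \<open>Column \<open>j\<close> of \<open>B\<close> vanishes below row \<open>j\<close>, so the
  formal sum is finite. The bound \<open>n\<close> is left free so that different sums can share one
  range, or have a range made of whole blocks.\<close>

lemma inf_mult_eq_sum:
  assumes "inf_upper_triangular B" "j < n"
  shows "inf_mult A B i j = (\<Sum>k<n. A i k * B k j)"
  unfolding inf_mult_def
proof (rule Sum_any.expand_superset)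
  show "{k. A i k * B k j \<noteq> 0} \<subseteq> {..<n}"
  proof
    fix k assume "k \<in> {k. A i k * B k j \<noteq> 0}"
    then have "B k j \<noteq> 0" by auto
    then have "k \<le> j"
      using assms(1) unfolding inf_upper_triangular_def by (meson not_le)
    then show "k \<in> {..<n}" using assms(2) by simp
  qed
qed simp

lemma inf_upper_triangular_mult:
  assumes "inf_upper_triangular A" "inf_upper_triangular B"
  shows "inf_upper_triangular (inf_mult A B)"
  unfolding inf_upper_triangular_def
proof (intro allI impI)
  fix i j :: nat assume "j < i"
  have "A i k * B k j = 0" if "k < Suc j" for k
    using assms(1) that \<open>j < i\<close> unfolding inf_upper_triangular_def by auto
  then show "inf_mult A B i j = 0"
    by (subst inf_mult_eq_sum[OF assms(2), of j "Suc j"]) (auto intro: sum.neutral)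
qed

text \<open>For a fixed column \<open>j\<close>, both inner and outer sums may be taken over
  \<open>k < Suc j\<close>, because triangularity of \<open>B\<close> and \<open>C\<close> confines
  all contributing indices there. What remains is a finite interchange of sums.\<close>

lemma inf_mult_assoc:
  assumes B: "inf_upper_triangular B" and C: "inf_upper_triangular C"
  shows "inf_mult (inf_mult A B) C = inf_mult A (inf_mult B C)"
proof (intro ext)
  fix i j
  let ?n = "Suc j"
  have "inf_mult (inf_mult A B) C i j = (\<Sum>k<?n. (\<Sum>l<?n. A i l * B l k) * C k j)"
    by (simp add: inf_mult_eq_sum[OF C, of j ?n] inf_mult_eq_sum[OF B, of _ ?n] del: sum.lessThan_Suc)
  also have "\<dots> = (\<Sum>l<?n. A i l * (\<Sum>k<?n. B l k * C k j))"
    unfolding sum_distrib_left sum_distrib_right mult.assoc by (rule sum.swap)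
  also have "\<dots> = inf_mult A (inf_mult B C) i j"
    by (simp add: inf_mult_eq_sum[OF inf_upper_triangular_mult[OF B C], of j ?n]
        inf_mult_eq_sum[OF C, of j ?n] del: sum.lessThan_Suc)
  finally show "inf_mult (inf_mult A B) C i j = inf_mult A (inf_mult B C) i j" .
qed

lemma inf_upper_triangular_one: "inf_upper_triangular inf_one"
  by (simp add: inf_upper_triangular_def inf_one_def)

lemma inf_mult_one_right: "inf_mult A inf_one = (A :: 'a :: semiring_1 inf_mat)"
  by (intro ext) (subst inf_mult_eq_sum[OF inf_upper_triangular_one lessI],
      simp add: inf_one_def if_distrib cong: if_cong)

lemma inf_mult_one_left:
  assumes "inf_upper_triangular (A :: 'a :: semiring_1 inf_mat)"
  shows "inf_mult inf_one A = A"
proof (intro ext)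
  fix i j
  have "inf_mult inf_one A i j = (\<Sum>k<Suc (max i j). inf_one i k * A k j)"
    by (rule inf_mult_eq_sum[OF assms]) simp
  also have "\<dots> = (\<Sum>k<Suc (max i j). if i = k then A k j else 0)"
    by (rule sum.cong) (auto simp: inf_one_def)
  also have "\<dots> = A i j"
    by (subst sum.delta') auto
  finally show "inf_mult inf_one A i j = A i j" .
qed

text \<open>Forward substitution: row \<open>i\<close> of the system \<open>X A = 1\<close> is
  solved column by column, dividing by the pivot \<open>A j j\<close>. The recursion is on the
  column index alone.\<close>

fun left_inverse :: "'a :: field inf_mat \<Rightarrow> 'a inf_mat" where
  "left_inverse A i j = (inf_one i j - (\<Sum>k<j. left_inverse A i k * A k j)) / A j j"

declare left_inverse.simps [simp del]

lemma left_inverse_below_diagonal: "j < i \<Longrightarrow> left_inverse A i j = 0"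
proof (induction j rule: less_induct)
  case (less j)
  then have "(\<Sum>k<j. left_inverse A i k * A k j) = 0"
    by (intro sum.neutral) auto
  with less.prems show ?case by (simp add: left_inverse.simps[of A i j] inf_one_def)
qed

lemma inf_upper_triangular_left_inverse: "inf_upper_triangular (left_inverse A)"
  by (simp add: inf_upper_triangular_def left_inverse_below_diagonal)

lemma left_inverse_diagonal: "left_inverse A i i = 1 / A i i"
proof -
  have "(\<Sum>k<i. left_inverse A i k * A k i) = 0"
    by (intro sum.neutral) (auto simp: left_inverse_below_diagonal)
  then show ?thesis by (simp add: left_inverse.simps[of A i i] inf_one_def)
qed

lemma left_inverse_mult:
  assumes "inf_upper_triangular A" "\<And>i. A i i \<noteq> 0"
  shows "inf_mult (left_inverse A) A = inf_one"
proof (intro ext)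
  fix i j
  have "left_inverse A i j * A j j = inf_one i j - (\<Sum>k<j. left_inverse A i k * A k j)"
    using assms(2)[of j] by (simp add: left_inverse.simps[of A i j])
  then show "inf_mult (left_inverse A) A i j = inf_one i j"
    by (simp add: inf_mult_eq_sum[OF assms(1) lessI])
qed

text \<open>The usual group argument: with \<open>C\<close> the left inverse of \<open>A\<close> and
  \<open>D\<close> the left inverse of \<open>C\<close>, associativity gives
  \<open>A = (D C) A = D (C A) = D\<close>, so \<open>D C = 1\<close> reads
  \<open>A C = 1\<close>.\<close>

lemma mult_left_inverse:
  assumes A: "inf_upper_triangular A" and "\<And>i. A i i \<noteq> 0"
  shows "inf_mult A (left_inverse A) = inf_one"
proof -
  let ?C = "left_inverse A"
  let ?D = "left_inverse ?C"
  have C: "inf_upper_triangular ?C" by (rule inf_upper_triangular_left_inverse)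
  have D: "inf_upper_triangular ?D" by (rule inf_upper_triangular_left_inverse)
  \<comment> \<open>The construction applies to \<open>C\<close> itself, since its diagonal entries
    \<open>1 / A i i\<close> are nonzero.\<close>
  have DC: "inf_mult ?D ?C = inf_one"
    using C by (rule left_inverse_mult) (simp add: left_inverse_diagonal assms)
  have CA: "inf_mult ?C A = inf_one" using assms by (rule left_inverse_mult)
  have "A = inf_mult (inf_mult ?D ?C) A" by (simp add: DC inf_mult_one_left A)
  also have "\<dots> = ?D" by (simp add: inf_mult_assoc C A CA inf_mult_one_right)
  finally show ?thesis using DC by simp
qed

text \<open>This discharges existence and uniqueness for the description in
  \<open>inf_inverse\<close>. Uniqueness is \<open>B = (C A) B = C (A B) = C\<close> with
  \<open>C\<close> the left inverse.\<close>

lemma inf_inverse_eq_left_inverse: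
  assumes A: "inf_upper_triangular A" and "\<And>i. A i i \<noteq> 0"
  shows "inf_inverse A = left_inverse A"
  unfolding inf_inverse_def
proof (rule the_equality)
  show "inf_upper_triangular (left_inverse A) \<and> inf_mult A (left_inverse A) = inf_one
      \<and> inf_mult (left_inverse A) A = inf_one"
    using inf_upper_triangular_left_inverse mult_left_inverse[OF assms] left_inverse_mult[OF assms]
    by blast
next
  fix B assume B: "inf_upper_triangular B \<and> inf_mult A B = inf_one \<and> inf_mult B A = inf_one"
  have "B = inf_mult (inf_mult (left_inverse A) A) B"
    using B by (simp add: left_inverse_mult assms inf_mult_one_left)
  also have "\<dots> = left_inverse A"
    using B by (simp add: inf_mult_assoc A inf_mult_one_right)
  finally show "B = left_inverse A" .
qed

lemma inf_mult_mult_inverse: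
  fixes A :: "'a :: field inf_mat"
  assumes "inf_upper_triangular A" "\<And>i. A i i \<noteq> 0"
  shows "inf_mult (inf_mult K A) (inf_inverse A) = K"
  by (simp add: inf_inverse_eq_left_inverse inf_mult_assoc assms
      inf_upper_triangular_left_inverse mult_left_inverse inf_mult_one_right)

subsection \<open>Finite matrices\<close>

text \<open>The determinant is the product of the diagonal entries, hence nonzero; this rules out
  the value \<open>None\<close> of \<open>mat_inverse\<close>, on which \<open>mat_inv\<close> would
  be unspecified.\<close>

lemma mat_inv:
  fixes A :: "'a :: field mat"
  assumes A: "A \<in> carrier_mat n n" and "upper_triangular A" and "\<And>i. i < n \<Longrightarrow> A $$ (i, i) \<noteq> 0"
  shows "mat_inv A \<in> carrier_mat n n" "mat_inv A * A = 1\<^sub>m n"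
proof -
  have "det A \<noteq> 0"
    using assms upper_triangular_imp_det_eq_0_iff[OF A] by (auto simp: diag_mat_def)
  then have "A \<in> Units (ring_mat TYPE('a) n ())" by (rule det_non_zero_imp_unit[OF A])
  then obtain B where B: "mat_inverse A = Some B"
    using mat_inverse(1)[OF A, where b = "()"] by (cases "mat_inverse A") auto
  show "mat_inv A \<in> carrier_mat n n" "mat_inv A * A = 1\<^sub>m n"
    using mat_inverse(2)[OF A B] by (simp_all add: mat_inv_def B)
qed

lemma invertible_upper_triangular_diagonal:
  fixes A :: "'a :: field mat"
  assumes A: "A \<in> carrier_mat n n" and "upper_triangular A" and "invertible_mat A" and "i < n"
  shows "A $$ (i, i) \<noteq> 0"
proof -
  from assms(3) obtain B where AB: "A * B = 1\<^sub>m n" and BA: "B * A = 1\<^sub>m (dim_row B)"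
    using A unfolding invertible_mat_def inverts_mat_def by auto
  \<comment> \<open>\<open>invertible_mat\<close> does not state the dimensions of \<open>B\<close>;
    they are read off by comparing column counts in the two identities.\<close>
  have "dim_col B = n" using arg_cong[OF AB, of dim_col] by simp
  moreover have "dim_row B = n" using arg_cong[OF BA, of dim_col] A by simp
  ultimately have "B \<in> carrier_mat n n" by auto
  then have "det A * det B = 1" using det_mult[OF A] AB by (metis det_one)
  then have "det A \<noteq> 0" by auto
  then show ?thesis
    using assms upper_triangular_imp_det_eq_0_iff[OF A] by (auto simp: diag_mat_def)
qed

lemma index_mult_mat_sum:
  assumes "A \<in> carrier_mat n n" "B \<in> carrier_mat n n" "u < n" "v < n"
  shows "(A * B) $$ (u, v) = (\<Sum>w<n. A $$ (u, w) * B $$ (w, v))"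
  using assms by (auto simp: scalar_prod_def atLeast0LessThan)

text \<open>This serves to get triangularity of \<open>Y * F_mat p\<close> without computing
  \<open>F_mat p\<close>: the product is a left factor of \<open>Y\<close> with cofactor
  \<open>F_inv_mat p\<close>, whose entries are explicit.\<close>

lemma upper_triangular_left_factor:
  fixes X A :: "'a :: field mat"
  assumes X: "X \<in> carrier_mat n n" and A: "A \<in> carrier_mat n n" "upper_triangular A"
    and dA: "\<And>i. i < n \<Longrightarrow> A $$ (i, i) \<noteq> 0" and XA: "upper_triangular (X * A)"
  shows "upper_triangular X" "i < n \<Longrightarrow> (X * A) $$ (i, i) = X $$ (i, i) * A $$ (i, i)"
proof -
  \<comment> \<open>Only \<open>w = v\<close> survives in the product: smaller \<open>w\<close> are
    killed by \<open>X\<close>, larger ones by the triangular \<open>A\<close>. Induction on the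
    column then clears each row of \<open>X\<close> left of the diagonal.\<close>
  have entry: "(X * A) $$ (u, v) = X $$ (u, v) * A $$ (v, v)"
    if "u < n" "v < n" and *: "\<And>w. w < v \<Longrightarrow> X $$ (u, w) = 0" for u v
  proof -
    have "(X * A) $$ (u, v) = (\<Sum>w<n. if w = v then X $$ (u, w) * A $$ (w, v) else 0)"
      unfolding index_mult_mat_sum[OF X A(1) that(1,2)]
    proof (rule sum.cong)
      fix w assume "w \<in> {..<n}"
      then have "v < w \<Longrightarrow> A $$ (w, v) = 0" using A by auto
      then show "X $$ (u, w) * A $$ (w, v) = (if w = v then X $$ (u, w) * A $$ (w, v) else 0)"
        using *[of w] by (cases w v rule: linorder_cases) auto
    qed simp
    then show ?thesis using that by simp
  qed
  have zero: "X $$ (u, v) = 0" if "u < n" "v < u" for u v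
    using that
  proof (induction v rule: less_induct)
    case (less v)
    have "(X * A) $$ (u, v) = X $$ (u, v) * A $$ (v, v)"
      using less by (intro entry) auto
    moreover have "(X * A) $$ (u, v) = 0" using XA X less.prems by auto
    ultimately show ?case using dA[of v] less.prems by simp
  qed
  then show "upper_triangular X" using X by auto
  show "(X * A) $$ (i, i) = X $$ (i, i) * A $$ (i, i)" if "i < n"
    using that zero by (intro entry) auto
qed

text \<open>Defined entrywise with explicit size \<open>e\<close>, so that identities between
  combinations of blocks reduce to identities between finite sums of scalars.\<close>

definition lincomb_mat :: "nat \<Rightarrow> nat \<Rightarrow> (nat \<Rightarrow> 'a) \<Rightarrow> (nat \<Rightarrow> 'a mat) \<Rightarrow> 'a :: comm_ring_1 mat" where
  "lincomb_mat e n c X = mat e e (\<lambda>(u, v). \<Sum>k<n. c k * X k $$ (u, v))"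

lemma lincomb_mat_carrier [simp]: "lincomb_mat e n c X \<in> carrier_mat e e"
  by (simp add: lincomb_mat_def)

lemma lincomb_mat_mult:
  assumes X: "\<And>k. X k \<in> carrier_mat e e" and A: "A \<in> carrier_mat e e"
  shows "lincomb_mat e n c X * A = lincomb_mat e n c (\<lambda>k. X k * A)"
proof (rule eq_matI)
  fix u v assume "u < dim_row (lincomb_mat e n c (\<lambda>k. X k * A))"
    "v < dim_col (lincomb_mat e n c (\<lambda>k. X k * A))"
  then have uv: "u < e" "v < e" by (auto simp: lincomb_mat_def)
  have "(lincomb_mat e n c X * A) $$ (u, v) = (\<Sum>w<e. (\<Sum>k<n. c k * X k $$ (u, w)) * A $$ (w, v))"
    using uv by (subst index_mult_mat_sum[OF _ A, of _ u v]) (auto simp: lincomb_mat_def)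
  also have "\<dots> = (\<Sum>k<n. c k * (\<Sum>w<e. X k $$ (u, w) * A $$ (w, v)))"
    unfolding sum_distrib_left sum_distrib_right mult.assoc by (rule sum.swap)
  also have "\<dots> = (\<Sum>k<n. c k * (X k * A) $$ (u, v))"
    by (simp only: index_mult_mat_sum[OF X A uv])
  finally show "(lincomb_mat e n c X * A) $$ (u, v) = lincomb_mat e n c (\<lambda>k. X k * A) $$ (u, v)"
    using uv by (simp add: lincomb_mat_def)
qed (use A in \<open>auto simp: lincomb_mat_def\<close>)

text \<open>For \<open>j < i\<close> the binomial coefficient is already 0, so this agrees with
  \<open>pascal_mat\<close> without a case distinction.\<close>

definition pascal_entry :: "'a :: comm_semiring_1 \<Rightarrow> nat \<Rightarrow> nat \<Rightarrow> 'a" where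
  "pascal_entry \<alpha> i j = of_nat (j choose i) * \<alpha> ^ (j - i)"

lemma pascal_entry_0_right: "pascal_entry \<alpha> i 0 = (if i = 0 then 1 else 0)"
  by (cases i) (simp_all add: pascal_entry_def)

lemma pascal_entry_Suc:
  "pascal_entry \<alpha> i (Suc j) = \<alpha> * pascal_entry \<alpha> i j + (if i = 0 then 0 else pascal_entry \<alpha> (i - 1) j)"
proof (cases i)
  case (Suc l)
  show ?thesis
  \<comment> \<open>Subtraction is truncated: the exponents \<open>j - l\<close> and
    \<open>j - Suc l\<close> differ by one only if \<open>l < j\<close>. Otherwise
    \<open>j choose Suc l\<close> is 0 and the term with \<alpha> disappears.\<close>
  proof (cases "l < j")
    case True
    then have "\<alpha> ^ (j - l) = \<alpha> * \<alpha> ^ (j - Suc l)"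
      by (metis Suc_diff_Suc power_Suc)
    then show ?thesis by (simp add: Suc pascal_entry_def algebra_simps)
  qed (simp add: Suc pascal_entry_def binomial_eq_0)
qed (simp add: pascal_entry_def)

subsection \<open>Sobol' matrices\<close>

lemma Q_mat_carrier [simp]: "Q_mat p \<in> carrier_mat (degree p) (degree p)"
  by (simp add: Q_mat_def)

lemma F_inv_mat_properties:
  shows "F_inv_mat p \<in> carrier_mat (degree p) (degree p)" "upper_triangular (F_inv_mat p)"
    "i < degree p \<Longrightarrow> F_inv_mat p $$ (i, i) = 1"
  by (auto simp: F_inv_mat_def)

lemma F_mat:
  shows F_mat_carrier [simp]: "F_mat p \<in> carrier_mat (degree p) (degree p)"
    and F_mat_mult_F_inv_mat: "F_mat p * F_inv_mat p = 1\<^sub>m (degree p)"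
  unfolding F_mat_def by (rule mat_inv; simp add: F_inv_mat_properties)+

lemma sobol_block_carrier [simp]:
  assumes "M0 \<in> carrier_mat (degree p) (degree p)"
  shows "sobol_block p M0 i j \<in> carrier_mat (degree p) (degree p)"
proof (induction j arbitrary: i)
  case (Suc j)
  then show ?case
    using assms by (cases j) (auto intro!: mult_carrier_mat add_carrier_mat)
qed simp

lemma sobol_block_row_0 [simp]: "sobol_block p M0 0 j = 0\<^sub>m (degree p) (degree p)"
  by (cases "(p, M0, 0 :: nat, j)" rule: sobol_block.cases) auto

section \<open>Triangular shape and diagonal of Sobol' matrices\<close>

lemma sobol_block_below_diagonal:
  "j < i \<Longrightarrow> sobol_block p M0 (Suc i) (Suc j) = 0\<^sub>m (degree p) (degree p)"
proof (induction j arbitrary: i)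
  case (Suc j)
  then obtain l where "i = Suc l" by (cases i) auto
  with Suc show ?case
    by (simp add: left_mult_zero_mat[OF F_mat_carrier] left_mult_zero_mat[OF Q_mat_carrier])
qed simp

text \<open>The left neighbour of a diagonal block is zero, so each diagonal block is its
  predecessor times \<open>F_mat p\<close>. Equivalently, multiplying it by the unitriangular
  \<open>F_inv_mat p\<close> gives back the predecessor, and the left factor lemma applies.\<close>

lemma sobol_block_diagonal:
  assumes M0: "M0 \<in> carrier_mat (degree p) (degree p)" "upper_triangular M0"
    and d: "\<And>u. u < degree p \<Longrightarrow> M0 $$ (u, u) \<noteq> 0"
  shows "upper_triangular (sobol_block p M0 (Suc i) (Suc i)) \<and>
    (\<forall>u<degree p. sobol_block p M0 (Suc i) (Suc i) $$ (u, u) \<noteq> 0)"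
proof (induction i)
  case (Suc i)
  let ?X = "sobol_block p M0 (Suc (Suc i)) (Suc (Suc i))"
  let ?Y = "sobol_block p M0 (Suc i) (Suc i)"
  note S = sobol_block_carrier[OF M0(1)]
  have "?X = ?Y * F_mat p"
    by (simp add: sobol_block_below_diagonal left_mult_zero_mat[OF Q_mat_carrier]
        left_add_zero_mat[OF S])
  then have XA: "?X * F_inv_mat p = ?Y"
    by (simp add: assoc_mult_mat[OF S F_mat_carrier F_inv_mat_properties(1)] F_mat_mult_F_inv_mat
        right_mult_one_mat[OF S] del: sobol_block.simps)
  note factor = upper_triangular_left_factor[OF S[of "Suc (Suc i)" "Suc (Suc i)"]
      F_inv_mat_properties(1,2), unfolded XA]
  have "upper_triangular ?X"
    using Suc by (intro factor) (auto simp: F_inv_mat_properties)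
  moreover have "?X $$ (u, u) \<noteq> 0" if "u < degree p" for u
  proof -
    have "?Y $$ (u, u) = ?X $$ (u, u) * F_inv_mat p $$ (u, u)"
      using Suc that by (intro factor) (auto simp: F_inv_mat_properties)
    then show ?thesis using Suc that by auto
  qed
  ultimately show ?case by blast
qed (use assms in simp)

lemma sobol_mat_upper_triangular:
  assumes "0 < degree p" and M0: "M0 \<in> carrier_mat (degree p) (degree p)" "upper_triangular M0"
    and "\<And>u. u < degree p \<Longrightarrow> M0 $$ (u, u) \<noteq> 0"
  shows "inf_upper_triangular (sobol_mat p M0)" "sobol_mat p M0 r r \<noteq> 0"
proof -
  let ?e = "degree p"
  note diag = sobol_block_diagonal[OF M0 assms(4)]
  show "sobol_mat p M0 r r \<noteq> 0"
    using diag[of "r div ?e"] assms(1) by (simp add: sobol_mat_def del: sobol_block.simps)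
  show "inf_upper_triangular (sobol_mat p M0)"
    unfolding inf_upper_triangular_def
  proof (intro allI impI)
    fix r s :: nat assume "s < r"
    then have "s div ?e \<le> r div ?e" by (simp add: div_le_mono)
    then consider "s div ?e < r div ?e" | "s div ?e = r div ?e" by linarith
    then show "sobol_mat p M0 r s = 0"
    proof cases
      case 1
      then show ?thesis
        using assms(1) by (simp add: sobol_mat_def sobol_block_below_diagonal del: sobol_block.simps)
    next
      case 2
      then have "s mod ?e < r mod ?e"
        using \<open>s < r\<close> by (metis add_less_cancel_left div_mult_mod_eq)
      moreover have "r mod ?e < dim_row (sobol_block p M0 (Suc (r div ?e)) (Suc (r div ?e)))"
        using sobol_block_carrier[OF M0(1), of "Suc (r div ?e)" "Suc (r div ?e)"] assms(1)
        by (simp del: sobol_block.simps)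
      ultimately show ?thesis
        using diag[of "r div ?e"] 2
        by (simp add: sobol_mat_def upper_triangularD del: sobol_block.simps)
    qed
  qed
qed

text \<open>Off the diagonal, \<open>F_inv_mat\<close> uses only coefficients of index strictly
  between 0 and the degree, so it does not see the constant term. In \<open>Q_mat\<close> the
  constant term sits exactly on the diagonal, with a minus sign that turns the shift by -\<alpha>
  into +\<alpha>.\<close>

lemma shift_poly:
  fixes p q :: "'a :: field poly"
  assumes "q = p - [:\<alpha>:]" "0 < degree p"
  shows "degree q = degree p" "F_mat q = F_mat p" "Q_mat q = Q_mat p + \<alpha> \<cdot>\<^sub>m 1\<^sub>m (degree p)"
proof -
  have *: "coeff q n = coeff p n" if "0 < n" for n
    using that by (cases n) (simp_all add: assms)
  have coeff_0: "coeff q 0 = coeff p 0 - \<alpha>" by (simp add: assms)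
  show deg: "degree q = degree p"
    using assms degree_add_eq_left[of "- [:\<alpha>:]" p] by (simp only: diff_conv_add_uminus) simp
  have "F_inv_mat q = F_inv_mat p"
    unfolding F_inv_mat_def deg by (rule cong_mat) (auto simp: *)
  then show "F_mat q = F_mat p" by (simp add: F_mat_def)
  show "Q_mat q = Q_mat p + \<alpha> \<cdot>\<^sub>m 1\<^sub>m (degree p)"
    by (rule eq_matI) (auto simp: Q_mat_def deg * coeff_0)
qed

text \<open>Block form of the product of the Pascal Kronecker matrix with the Sobol' matrix of
  \<open>p\<close>. Blocks of \<open>p\<close> in column \<open>Suc j\<close> vanish below the
  diagonal, which bounds the sum. The induction runs over block columns, for all block rows at
  once.\<close>

lemma sobol_block_shift:
  fixes p q :: "'a :: field poly"
  assumes q: "q = p - [:\<alpha>:]" "0 < degree p"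
    and M0: "M0 \<in> carrier_mat (degree p) (degree p)" and K0: "K0 \<in> carrier_mat (degree p) (degree p)"
  shows "sobol_block q (K0 * M0) (Suc i) (Suc j) =
    lincomb_mat (degree p) (Suc j) (pascal_entry \<alpha> i) (\<lambda>k. K0 * sobol_block p M0 (Suc k) (Suc j))"
proof (induction j arbitrary: i)
  case 0
  have "K0 * M0 \<in> carrier_mat (degree p) (degree p)" using M0 K0 by simp
  then show ?case
    by (intro eq_matI) (auto simp: lincomb_mat_def pascal_entry_0_right shift_poly(1)[OF q])
next
  case (Suc j)
  define e where "e = degree p"
  let ?Q = "Q_mat p" and ?F = "F_mat p" and ?c = "pascal_entry \<alpha> i"
  define S where "S k = sobol_block p M0 k (Suc j)" for k
  define X where "X k = K0 * S (Suc k)" for k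
  have carr: "S k \<in> carrier_mat e e" "K0 \<in> carrier_mat e e" "?Q \<in> carrier_mat e e"
    "?F \<in> carrier_mat e e" "X k \<in> carrier_mat e e" for k
    using M0 K0 by (simp_all add: S_def X_def e_def del: sobol_block.simps)
  define R where "R = (\<lambda>i. sobol_block q (K0 * M0) i (Suc j))"
  have R: "R (Suc l) = lincomb_mat e (Suc j) (pascal_entry \<alpha> l) X" for l
    unfolding R_def X_def S_def e_def by (rule Suc)
  have R0: "R 0 = 0\<^sub>m e e"
    by (simp add: R_def e_def shift_poly(1)[OF q])
  have carrR: "R l \<in> carrier_mat e e" for l
    by (cases l) (simp_all add: R R0)
  \<comment> \<open>The recurrence before multiplication by the factor \<open>F_mat\<close>, which
    is the same for both polynomials. The right side already has one more summand, as the next block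
    column requires.\<close>
  have "R (Suc i) * Q_mat q + R i =
    lincomb_mat e (Suc (Suc j)) ?c (\<lambda>k. X k * ?Q + K0 * S k)" (is "?L = ?R")
  proof (rule eq_matI)
    fix u v assume "u < dim_row ?R" "v < dim_col ?R"
    then have uv: "u < e" "v < e" by (simp_all add: lincomb_mat_def)
    have sum_entry: "(X k * ?Q + K0 * S k) $$ (u, v) = (X k * ?Q) $$ (u, v) + (K0 * S k) $$ (u, v)" for k
      using uv carr(1)[of k] carr(2,3) by simp
    have Xj: "X (Suc j) = 0\<^sub>m e e"
      using right_mult_zero_mat[OF carr(2)]
      by (simp add: X_def S_def sobol_block_below_diagonal e_def)
    have Ri: "R i $$ (u, v) = (\<Sum>k<Suc j. (if i = 0 then 0 else pascal_entry \<alpha> (i - 1) k) * X k $$ (u, v))"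
      using uv by (cases i) (simp_all add: R R0 lincomb_mat_def)
    have "Q_mat q = ?Q + \<alpha> \<cdot>\<^sub>m 1\<^sub>m e"
      unfolding e_def by (rule shift_poly(3)[OF q])
    then have "R (Suc i) * Q_mat q = R (Suc i) * ?Q + \<alpha> \<cdot>\<^sub>m R (Suc i)"
      using carrR[of "Suc i"] carr(3)
      by (simp add: mult_add_distrib_mat[of _ e e _ e] mult_smult_distrib[of _ e e _ e])
    then have "?L $$ (u, v) = (R (Suc i) * ?Q) $$ (u, v) + \<alpha> * R (Suc i) $$ (u, v) + R i $$ (u, v)"
      using uv carrR[of i] carrR[of "Suc i"] carr(3) by simp
    also have "\<dots> = (\<Sum>k<Suc j. ?c k * (X k * ?Q) $$ (u, v)) +
       (\<alpha> * (\<Sum>k<Suc j. ?c k * X k $$ (u, v)) +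
        (\<Sum>k<Suc j. (if i = 0 then 0 else pascal_entry \<alpha> (i - 1) k) * X k $$ (u, v)))"
      unfolding Ri R lincomb_mat_mult[OF carr(5,3)]
      using uv by (simp add: lincomb_mat_def)
    \<comment> \<open>Here the scalar part of \<open>Q_mat q\<close> and the previous block row
      merge by Pascal's rule into coefficients with index \<open>Suc k\<close>.\<close>
    also have "\<alpha> * (\<Sum>k<Suc j. ?c k * X k $$ (u, v)) +
        (\<Sum>k<Suc j. (if i = 0 then 0 else pascal_entry \<alpha> (i - 1) k) * X k $$ (u, v)) =
        (\<Sum>k<Suc j. ?c (Suc k) * (K0 * S (Suc k)) $$ (u, v))"
      unfolding pascal_entry_Suc sum_distrib_left sum.distrib[symmetric] X_def
      by (rule sum.cong) (simp_all add: algebra_simps)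
    \<comment> \<open>After the index shift the term \<open>k = 0\<close> is added at no cost,
      because \<open>S 0\<close> is the zero boundary block.\<close>
    also have "\<dots> = (\<Sum>k<Suc (Suc j). ?c k * (K0 * S k) $$ (u, v))"
      using uv right_mult_zero_mat[OF carr(2), of e]
      by (subst sum.lessThan_Suc_shift[of _ "Suc j"]) (simp add: S_def e_def)
    \<comment> \<open>The added term \<open>k = Suc j\<close> is zero since its block lies below the
      diagonal.\<close>
    also have "(\<Sum>k<Suc j. ?c k * (X k * ?Q) $$ (u, v)) = (\<Sum>k<Suc (Suc j). ?c k * (X k * ?Q) $$ (u, v))"
      using uv left_mult_zero_mat[OF carr(3), of e]
      by (subst sum.lessThan_Suc[of _ "Suc j"]) (simp add: Xj)
    also have "\<dots> + (\<Sum>k<Suc (Suc j). ?c k * (K0 * S k) $$ (u, v)) = ?R $$ (u, v)"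
      unfolding sum.distrib[symmetric] lincomb_mat_def
      using uv by (simp add: sum_entry distrib_left del: sum.lessThan_Suc)
    finally show "?L $$ (u, v) = ?R $$ (u, v)" .
  qed (use carrR[of i] in \<open>auto simp: lincomb_mat_def\<close>)
  \<comment> \<open>\<open>K0\<close> acts on the left and the recurrence on the right, so
    \<open>K0\<close> can be pulled out and the recurrence of \<open>p\<close> reappears.\<close>
  moreover have "X k * ?Q + K0 * S k = K0 * (S (Suc k) * ?Q + S k)" for k
    using mult_add_distrib_mat[of K0 e e "S (Suc k) * ?Q" e "S k"] carr(2,3) carr(1)[of k] carr(1)[of "Suc k"]
    by (simp add: X_def assoc_mult_mat[of _ e e _ e _ e])
  ultimately have "R (Suc i) * Q_mat q + R i =
    lincomb_mat e (Suc (Suc j)) ?c (\<lambda>k. K0 * (S (Suc k) * ?Q + S k))" by simp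
  then have "sobol_block q (K0 * M0) (Suc i) (Suc (Suc j)) =
    lincomb_mat e (Suc (Suc j)) ?c (\<lambda>k. K0 * (S (Suc k) * ?Q + S k)) * ?F"
    by (simp add: R_def shift_poly(2)[OF q])
  also have "\<dots> = lincomb_mat e (Suc (Suc j)) ?c (\<lambda>k. K0 * (S (Suc k) * ?Q + S k) * ?F)"
    using carr by (intro lincomb_mat_mult) auto
  also have "(\<lambda>k. K0 * (S (Suc k) * ?Q + S k) * ?F) = (\<lambda>k. K0 * sobol_block p M0 (Suc k) (Suc (Suc j)))"
  proof
    fix k
    have "K0 * (S (Suc k) * ?Q + S k) * ?F = K0 * ((S (Suc k) * ?Q + S k) * ?F)"
      using carr by (intro assoc_mult_mat[of _ e e _ e _ e]) auto
    then show "K0 * (S (Suc k) * ?Q + S k) * ?F = K0 * sobol_block p M0 (Suc k) (Suc (Suc j))"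
      by (simp add: S_def)
  qed
  finally show ?case by (simp add: e_def)
qed

section \<open>The infinite Kronecker product as candidate for \<open>K\<close>\<close>

definition pascal_kronecker :: "'a :: comm_semiring_1 \<Rightarrow> nat \<Rightarrow> 'a mat \<Rightarrow> 'a inf_mat" where
  "pascal_kronecker \<alpha> e K0 = (\<lambda>r s. pascal_entry \<alpha> (r div e) (s div e) * K0 $$ (r mod e, s mod e))"

lemma sobol_mat_shift:
  fixes p q :: "'a :: field poly"
  assumes q: "q = p - [:\<alpha>:]" "0 < degree p"
    and M0: "M0 \<in> carrier_mat (degree p) (degree p)" and K0: "K0 \<in> carrier_mat (degree p) (degree p)"
    and "inf_upper_triangular (sobol_mat p M0)"
  shows "sobol_mat q (K0 * M0) = inf_mult (pascal_kronecker \<alpha> (degree p) K0) (sobol_mat p M0)"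
proof (intro ext)
  fix r s
  define e where "e = degree p"
  define i u j v where "i = r div e" "u = r mod e" "j = s div e" "v = s mod e"
  note ijuv = this
  have e: "0 < e" and uv: "u < e" "v < e" using q(2) by (simp_all add: e_def ijuv)
  let ?S = "\<lambda>k. sobol_block p M0 (Suc k) (Suc j)"
  let ?g = "\<lambda>k. pascal_kronecker \<alpha> e K0 r k * sobol_mat p M0 k s"
  have g: "?g (k * e + w) = pascal_entry \<alpha> i k * (K0 $$ (u, w) * ?S k $$ (w, v))" if "w < e" for k w
    using that by (simp add: pascal_kronecker_def sobol_mat_def e_def[symmetric] ijuv[symmetric]
        mult.assoc del: sobol_block.simps)
  \<comment> \<open>The bound is rounded up past \<open>s\<close> to a multiple of \<open>e\<close>,
    so that the range splits into \<open>Suc j\<close> whole blocks of length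
    \<open>e\<close>.\<close>
  have "inf_mult (pascal_kronecker \<alpha> e K0) (sobol_mat p M0) r s = (\<Sum>k<Suc j * e. ?g k)"
    using e by (intro inf_mult_eq_sum assms) (simp add: ijuv dividend_less_div_times)
  also have "\<dots> = (\<Sum>k<Suc j. \<Sum>w<e. ?g (k * e + w))"
    unfolding sum.nat_group[symmetric]
    by (simp only: sum.atLeastLessThan_shift_0[of _ "_ * e"] add_diff_cancel_left' atLeast0LessThan comp_def)
  also have "\<dots> = (\<Sum>k<Suc j. pascal_entry \<alpha> i k * (K0 * ?S k) $$ (u, v))"
  proof (intro sum.cong refl)
    fix k
    have "(\<Sum>w<e. ?g (k * e + w)) = pascal_entry \<alpha> i k * (\<Sum>w<e. K0 $$ (u, w) * ?S k $$ (w, v))"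
      unfolding sum_distrib_left by (intro sum.cong g) auto
    also have "(\<Sum>w<e. K0 $$ (u, w) * ?S k $$ (w, v)) = (K0 * ?S k) $$ (u, v)"
      using uv K0 M0 by (intro index_mult_mat_sum[symmetric]) (simp_all add: e_def del: sobol_block.simps)
    finally show "(\<Sum>w<e. ?g (k * e + w)) = pascal_entry \<alpha> i k * (K0 * ?S k) $$ (u, v)" .
  qed
  also have "\<dots> = sobol_block q (K0 * M0) (Suc i) (Suc j) $$ (u, v)"
    unfolding sobol_block_shift[OF q M0 K0] lincomb_mat_def e_def[symmetric] using uv by simp
  also have "\<dots> = sobol_mat q (K0 * M0) r s"
    by (simp add: sobol_mat_def ijuv e_def shift_poly(1)[OF q] del: sobol_block.simps)
  finally show "sobol_mat q (K0 * M0) r s =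
      inf_mult (pascal_kronecker \<alpha> (degree p) K0) (sobol_mat p M0) r s"
    by (simp add: e_def)
qed

lemma truncate_pascal_kronecker:
  assumes "K0 \<in> carrier_mat e e"
  shows "truncate_mat (e * m) (pascal_kronecker \<alpha> e K0) = kronecker (pascal_mat \<alpha> m) K0"
  unfolding truncate_mat_def kronecker_def
  using assms
  by (intro cong_mat)
    (auto simp: pascal_mat_def pascal_kronecker_def pascal_entry_def binomial_eq_0 mult.commute less_mult_imp_div_less)

lemma inf_block_pascal_kronecker:
  assumes "K0 \<in> carrier_mat e e"
  shows "inf_block e (pascal_kronecker \<alpha> e K0) (Suc i) (Suc j) = pascal_entry \<alpha> i j \<cdot>\<^sub>m K0"
  using assms by (intro eq_matI) (auto simp: inf_block_def pascal_kronecker_def)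

lemma inf_block_pascal_kronecker_recurrence:
  fixes K0 :: "'a :: comm_ring_1 mat" and \<alpha> :: 'a
  assumes K0: "K0 \<in> carrier_mat e e" and "1 \<le> i" "2 \<le> j"
  defines "K \<equiv> pascal_kronecker \<alpha> e K0"
  shows "inf_block e K i j = \<alpha> \<cdot>\<^sub>m inf_block e K i (j - 1) + inf_block e K (i - 1) (j - 1)"
proof -
  obtain k l where ij: "i = Suc k" "j = Suc (Suc l)"
    using assms(2,3) by (metis Suc_le_D numeral_2_eq_2 Suc_le_mono One_nat_def)
  show ?thesis
  proof (cases k)
    case 0
    \<comment> \<open>In the first block row the predecessor is the boundary block with row index 0,
      zero by convention.\<close>
    have "inf_block e K 0 (Suc l) = 0\<^sub>m e e" by (simp add: inf_block_def)
    then show ?thesis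
      using K0 by (intro eq_matI)
        (auto simp: ij 0 K_def inf_block_pascal_kronecker pascal_entry_Suc)
  next
    case (Suc n)
    then show ?thesis
      using K0 by (intro eq_matI)
        (auto simp: ij K_def inf_block_pascal_kronecker pascal_entry_Suc algebra_simps)
  qed
qed

theorem lemma1:
  fixes p :: "'b :: prime_card mod_ring poly"
    and c1 c2 \<alpha> :: "'b mod_ring"
    and e :: nat
    and M1 M2 K0 :: "'b mod_ring mat"
    and K :: "'b mod_ring inf_mat"
  assumes "e \<ge> 1" and "degree p = e"
    and "irreducible (p + [:c1:])" and "degree (p + [:c1:]) = e"
    and "irreducible (p + [:c2:])" and "degree (p + [:c2:]) = e"
    and "p + [:c1:] \<noteq> p + [:c2:]"
    and "M1 \<in> carrier_mat e e" and "upper_triangular M1" and "invertible_mat M1"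
    and "M2 \<in> carrier_mat e e" and "upper_triangular M2" and "invertible_mat M2"
    and "\<alpha> = c1 - c2"
    and "K = inf_mult (sobol_mat (p + [:c2:]) M2) (inf_inverse (sobol_mat (p + [:c1:]) M1))"
    and "K0 = M2 * mat_inv M1"
  shows "(\<forall>m\<ge>1. truncate_mat (e * m) K = kronecker (pascal_mat \<alpha> m) K0) \<and>
         (\<forall>i\<ge>1. \<forall>j\<ge>2. inf_block e K i j =
            \<alpha> \<cdot>\<^sub>m inf_block e K i (j - 1) + inf_block e K (i - 1) (j - 1)) \<and>
         (\<forall>i\<ge>1. inf_block e K i 1 = (if i = 1 then K0 else 0\<^sub>m e e))"
proof -
  let ?p = "p + [:c1:]" and ?q = "p + [:c2:]"
  have q: "?q = ?p - [:\<alpha>:]" using assms(14) by simp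
  have deg: "degree ?p = e" "0 < degree ?p" using assms(1,4) by simp_all
  note M1 = assms(8,9)
  have dM1: "M1 $$ (u, u) \<noteq> 0" if "u < e" for u
    using invertible_upper_triangular_diagonal[OF M1 assms(10) that] .
  note inv = mat_inv[OF M1 dM1]
  have K0: "K0 \<in> carrier_mat e e" using assms(11,16) inv(1) by simp
  \<comment> \<open>This puts the second initialization into the shape needed by
    \<open>sobol_mat_shift\<close>.\<close>
  have M2: "M2 = K0 * M1"
    using assms(11,16) inv M1(1) by (simp add: assoc_mult_mat[of _ e e _ e _ e])
  have ut: "inf_upper_triangular (sobol_mat ?p M1)" "sobol_mat ?p M1 r r \<noteq> 0" for r
    using M1 dM1 deg(1) by (intro sobol_mat_upper_triangular[OF deg(2)]; simp)+
  have "sobol_mat ?q M2 = inf_mult (pascal_kronecker \<alpha> e K0) (sobol_mat ?p M1)"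
    using sobol_mat_shift[OF q deg(2), of M1 K0] M1(1) K0 ut(1) M2 deg(1) by simp
  \<comment> \<open>The Sobol' matrix of the first polynomial cancels against its inverse on the
    right; both forms of the conclusion are then read off the explicit entries.\<close>
  then have K: "K = pascal_kronecker \<alpha> e K0"
    using assms(15) inf_mult_mult_inverse[OF ut] by simp
  have "inf_block e K i 1 = (if i = 1 then K0 else 0\<^sub>m e e)" if i: "1 \<le> i" for i
  proof -
    obtain k where k: "i = Suc k" using i by (cases i) auto
    show ?thesis
      using inf_block_pascal_kronecker[OF K0, of \<alpha> k 0] K0
      by (intro eq_matI) (auto simp: K k pascal_entry_0_right)
  qed
  then show ?thesis
    using truncate_pascal_kronecker[OF K0] inf_block_pascal_kronecker_recurrence[OF K0]
    by (simp add: K)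
qed

end
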